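(* Let $n$ be a positive integer, let $w\in\mathbb{R}^n$ with $\|w\|<1$, and let $\mathcal{B}=\{v_1,\dots,v_n,w\}$ be a triangular Parseval frame in $\mathbb{R}^n$. Then $\mathcal{B}$ is unique in the following sense: if $\mathcal{B}'=\{v_1',\dots,v_n',w\}$ is another triangular Parseval frame in $\mathbb{R}^n$ (with the same vector $w$), then for every $j\in\{1,\dots,n\}$ one has $v_j'=v_j$ or $v_j'=-v_j$.
   Context: $\langle\cdot,\cdot\rangle$ and $\|\cdot\|$ are the usual scalar product and norm on $\mathbb{R}^n$. A (finite, indexed) family $\{u_1,\dots,u_N\}$ of vectors in $\mathbb{R}^n$ is a Parseval frame if $\sum_{j=1}^N\langle v,u_j\rangle^2=\|v\|^2$ for every $v\in\mathbb{R}^n$. A matrix $(a_{i,j})_{1\le i,j\le n}$ is right-triangular if $a_{i,j}=0$ whenever $i>j$. A frame $\{v_1,\dots,v_n,w\}$ of $n+1$ vectors in $\mathbb{R}^n$ is triangular if the $n\times n$ matrix $(v_1,\dots,v_n)$ whose columns are its first $n$ vectors $v_1,\dots,v_n$ is right-triangular. *)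

theory Defs
  imports "HOL-Analysis.Analysis"
begin

text \<open>
  The index type \<open>'n\<close> ranges over the finite linearly ordered types: it plays the role of
  \<open>{1, \<dots>, n}\<close> with \<open>n = CARD('n)\<close>, and the order is the one used in ``triangular''.
  Families of \<open>n + 1\<close> vectors are indexed by \<open>'n option\<close>, where \<open>None\<close> is the extra last index.
\<close>

definition parseval_frame :: "('i::finite \<Rightarrow> real ^ 'n) \<Rightarrow> bool" where
  "parseval_frame u \<longleftrightarrow> (\<forall>v. (\<Sum>j\<in>UNIV. (v \<bullet> u j)\<^sup>2) = (norm v)\<^sup>2)"

text \<open>In \<open>A $ i $ j\<close> the row index \<open>i\<close> comes first.\<close>

definition right_triangular :: "real ^ 'n::{finite,linorder} ^ 'n::{finite,linorder} \<Rightarrow> bool" where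
  "right_triangular A \<longleftrightarrow> (\<forall>i j. i > j \<longrightarrow> A $ i $ j = 0)"

definition matrix_of_columns :: "('n \<Rightarrow> real ^ 'n) \<Rightarrow> real ^ 'n ^ 'n" where
  "matrix_of_columns v = (\<chi> i j. v j $ i)"

definition adjoin_last :: "('n \<Rightarrow> 'a) \<Rightarrow> 'a \<Rightarrow> 'n option \<Rightarrow> 'a" where
  "adjoin_last v w = case_option w v"

definition triangular_family :: "('n::{finite,linorder} option \<Rightarrow> real ^ 'n::{finite,linorder}) \<Rightarrow> bool" where
  "triangular_family u \<longleftrightarrow> right_triangular (matrix_of_columns (\<lambda>j. u (Some j)))"

definition triangular_parseval_frame :: "('n::{finite,linorder} option \<Rightarrow> real ^ 'n::{finite,linorder}) \<Rightarrow> bool" where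
  "triangular_parseval_frame u \<longleftrightarrow> parseval_frame u \<and> triangular_family u"

end

theory Submission
  imports Defs
begin

text \<open>
  The theorem is the uniqueness of a triangular (Cholesky) factorization. Let \<open>A\<close> be the matrix with
  columns \<open>v\<^sub>1, \<dots>, v\<^sub>n\<close>. Polarizing the Parseval identity gives \<open>A A\<^sup>T = I - w w\<^sup>T\<close>, so the products
  of the rows of \<open>A\<close> depend on \<open>w\<close> only (\<open>parseval_row_products\<close>). In such a product of row \<open>j\<close> with
  any row, triangularity removes the columns before \<open>j\<close>, and the columns after \<open>j\<close> contribute the
  same for \<open>v\<close> and \<open>v'\<close> if these agree there up to sign. Going down from the last column, this
  determines \<open>v\<^sub>j\<close> times its own diagonal entry, hence \<open>v\<^sub>j\<close> up to sign once that entry is nonzero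
  (\<open>triangular_columns_unique_up_to_sign\<close>).

  The condition \<open>norm w < 1\<close> is what makes the diagonal nonzero: a vector orthogonal to all
  \<open>v\<^sub>j\<close> has all of its norm seen by \<open>w\<close>, which Cauchy-Schwarz forbids, so the \<open>v\<^sub>j\<close> span the space
  (\<open>parseval_span_without_last\<close>), and \<open>n\<close> triangular spanning columns have no zero on the diagonal
  (\<open>triangular_spanning_diagonal_nonzero\<close>).
\<close>

lemma parseval_frame_inner:
  fixes u :: "'i::finite \<Rightarrow> real ^ 'n"
  assumes "parseval_frame u"
  shows "(\<Sum>j\<in>UNIV. (x \<bullet> u j) * (y \<bullet> u j)) = x \<bullet> y"
proof -
  have P: "(\<Sum>j\<in>UNIV. (z \<bullet> u j)\<^sup>2) = z \<bullet> z" for z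
    using assms by (simp add: parseval_frame_def power2_norm_eq_inner)
  have "(\<Sum>j\<in>UNIV. ((x + y) \<bullet> u j)\<^sup>2) =
      (\<Sum>j\<in>UNIV. (x \<bullet> u j)\<^sup>2) + (\<Sum>j\<in>UNIV. (y \<bullet> u j)\<^sup>2) + 2 * (\<Sum>j\<in>UNIV. (x \<bullet> u j) * (y \<bullet> u j))"
    by (simp add: inner_add_left power2_sum sum.distrib sum_distrib_left mult.assoc)
  then show ?thesis
    unfolding P by (simp add: inner_add_left inner_add_right inner_commute[of y x])
qed

lemma parseval_adjoin_last_inner:
  fixes v :: "'n::finite \<Rightarrow> real ^ 'n"
  assumes "parseval_frame (adjoin_last v w)"
  shows "(\<Sum>j\<in>UNIV. (x \<bullet> v j) * (y \<bullet> v j)) = x \<bullet> y - (x \<bullet> w) * (y \<bullet> w)"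
  using parseval_frame_inner[OF assms, of x y]
  by (simp add: UNIV_option_conv adjoin_last_def sum.reindex)

lemma parseval_row_products:
  fixes v :: "'n::finite \<Rightarrow> real ^ 'n"
  assumes "parseval_frame (adjoin_last v w)"
  shows "(\<Sum>k\<in>UNIV. v k $ i * v k $ j) = axis i 1 \<bullet> (axis j 1 :: real ^ 'n) - w $ i * w $ j"
  using parseval_adjoin_last_inner[OF assms, of "axis i 1" "axis j 1"]
  by (simp add: inner_axis')

text \<open>
  If \<open>a\<close> is orthogonal to every \<open>v j\<close>, then the Parseval identity reads
  \<open>(norm a)\<^sup>2 = (a \<bullet> w)\<^sup>2 \<le> (norm a)\<^sup>2 * (norm w)\<^sup>2\<close>, so that \<open>a = 0\<close>.
\<close>

lemma parseval_span_without_last: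
  fixes v :: "'n::finite \<Rightarrow> real ^ 'n"
  assumes "norm w < 1" and "parseval_frame (adjoin_last v w)"
  shows "span (range v) = UNIV"
proof (rule ccontr)
  assume "span (range v) \<noteq> UNIV"
  then obtain a where "a \<noteq> 0" and orth: "\<forall>x\<in>span (range v). a \<bullet> x = 0"
    using span_not_UNIV_orthogonal by blast
  have "a \<bullet> v j = 0" for j
    using orth by (simp add: span_base)
  then have "(norm a)\<^sup>2 = (a \<bullet> w)\<^sup>2"
    using parseval_adjoin_last_inner[OF assms(2), of a a]
    unfolding power2_norm_eq_inner by (simp add: power2_eq_square)
  then have "norm a = \<bar>a \<bullet> w\<bar>"
    by (metis abs_norm_cancel power2_eq_iff abs_minus_cancel)
  also have "\<dots> \<le> norm a * norm w"
    by (rule Cauchy_Schwarz_ineq2)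
  also have "\<dots> < norm a * 1"
    using \<open>a \<noteq> 0\<close> assms(1) by (intro mult_strict_left_mono) auto
  finally show False by simp
qed

text \<open>
  As many spanning vectors as the dimension are independent. A zero at position \<open>j\<close> of the
  diagonal would place the columns up to \<open>j\<close> in the space of the
  coordinates before \<open>j\<close>, whose dimension is too small for that many independent vectors.
\<close>

lemma triangular_spanning_diagonal_nonzero:
  fixes v :: "'n::{finite,linorder} \<Rightarrow> real ^ 'n::{finite,linorder}"
  assumes triangular: "\<And>i k. k < i \<Longrightarrow> v k $ i = 0"
    and spanning: "span (range v) = UNIV"
  shows "v j $ j \<noteq> 0"
proof
  assume zero: "v j $ j = 0"
  have "dim (UNIV :: (real ^ 'n::{finite,linorder}) set) \<le> card (range v)"
    using spanning by (intro dim_le_card) auto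
  then have card: "card (range v) = CARD('n)"
    using card_image_le[of UNIV v] by simp
  then have inj: "inj v"
    by (intro eq_card_imp_inj_on) auto
  have "independent (range v)"
    using spanning card by (intro card_le_dim_spanning[of _ UNIV]) auto
  then have indep: "independent (v ` {..j})"
    by (rule independent_mono) auto
  let ?E = "(\<lambda>i. axis i 1 :: real ^ 'n::{finite,linorder}) ` {..<j}"
  have "v k \<in> span ?E" if "k \<le> j" for k
  proof -
    have "v k $ i = 0" if "i \<notin> {..<j}" for i
      using triangular[of k i] zero \<open>k \<le> j\<close> that by (cases "k = i") auto
    then have "(\<Sum>i\<in>{..<j}. v k $ i *s axis i 1) = (\<Sum>i\<in>UNIV. v k $ i *s axis i 1)"
      by (intro sum.mono_neutral_left) auto
    also have "\<dots> = v k"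
      by (rule basis_expansion)
    finally have expansion: "v k = (\<Sum>i\<in>{..<j}. v k $ i *\<^sub>R axis i 1)"
      by (simp add: scalar_mult_eq_scaleR)
    show ?thesis
      by (subst expansion) (intro span_sum span_scale span_base imageI)
  qed
  then have "card (v ` {..j}) \<le> card ?E"
    using indep by (intro independent_span_bound[THEN conjunct2]) auto
  also have "\<dots> \<le> card {..<j}"
    by (rule card_image_le) simp
  also have "\<dots> < card {..j}"
    by (rule psubset_card_mono) auto
  also have "\<dots> = card (v ` {..j})"
    using inj by (simp add: card_image inj_on_subset)
  finally show False by simp
qed

text \<open>
  With the later columns known up to sign, the product of rows \<open>i\<close> and \<open>j\<close> leaves
  \<open>v j $ i * v j $ j\<close> as its only unknown term. The case \<open>i = j\<close> fixes the diagonal entry up to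
  sign, and dividing by it the other cases fix the whole column with that same sign.
\<close>

lemma triangular_columns_unique_up_to_sign:
  fixes v v' :: "'n::{finite,linorder} \<Rightarrow> real ^ 'n::{finite,linorder}"
  assumes triangular: "\<And>i k. k < i \<Longrightarrow> v k $ i = 0"
    and triangular': "\<And>i k. k < i \<Longrightarrow> v' k $ i = 0"
    and products: "\<And>i j. (\<Sum>k\<in>UNIV. v' k $ i * v' k $ j) = (\<Sum>k\<in>UNIV. v k $ i * v k $ j)"
    and diagonal: "\<And>j. v j $ j \<noteq> 0"
  shows "v' j = v j \<or> v' j = - v j"
proof (induction "card {j<..}" arbitrary: j rule: less_induct)
  case less
  have later: "v' k = v k \<or> v' k = - v k" if "j < k" for k
    using that by (intro less psubset_card_mono) auto
  have eq: "v' j $ i * v' j $ j = v j $ i * v j $ j" for i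
  proof -
    have "v' k $ i * v' k $ j = v k $ i * v k $ j" if "k \<noteq> j" for k
      using that later[of k] triangular[of k j] triangular'[of k j]
      by (cases k j rule: linorder_cases) auto
    then have "(\<Sum>k\<in>UNIV - {j}. v' k $ i * v' k $ j) = (\<Sum>k\<in>UNIV - {j}. v k $ i * v k $ j)"
      by (intro sum.cong) auto
    with products[of i j] show ?thesis
      by (simp add: sum.remove[of UNIV j])
  qed
  from eq[of j] have "v' j $ j = v j $ j \<or> v' j $ j = - (v j $ j)"
    by (simp add: square_eq_iff)
  then show ?case
  proof
    assume "v' j $ j = v j $ j"
    then have "v' j $ i = v j $ i" for i
      using eq[of i] diagonal[of j] by simp
    then show ?thesis by (simp add: vec_eq_iff)
  next
    assume "v' j $ j = - (v j $ j)"
    then have "(v' j $ i + v j $ i) * v j $ j = 0" for i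
      using eq[of i] by (simp add: distrib_right)
    then have "v' j $ i = - (v j $ i)" for i
      using diagonal[of j] by (simp add: eq_neg_iff_add_eq_0)
    then show ?thesis by (simp add: vec_eq_iff)
  qed
qed

lemma triangular_family_adjoin_lastD:
  assumes "triangular_family (adjoin_last v w)" and "k < i"
  shows "v k $ i = 0"
  using assms
  by (simp add: triangular_family_def right_triangular_def matrix_of_columns_def adjoin_last_def)

theorem theorem1p1:
  fixes w :: "real ^ 'n::{finite,linorder}"
    and v v' :: "'n::{finite,linorder} \<Rightarrow> real ^ 'n::{finite,linorder}"
  assumes "norm w < 1"
    and "triangular_parseval_frame (adjoin_last v w)"
    and "triangular_parseval_frame (adjoin_last v' w)"
  shows "\<forall>j. v' j = v j \<or> v' j = - v j"
proof
  fix j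
  have frames: "parseval_frame (adjoin_last v w)" "parseval_frame (adjoin_last v' w)"
    and triangular: "triangular_family (adjoin_last v w)" "triangular_family (adjoin_last v' w)"
    using assms(2,3) by (simp_all add: triangular_parseval_frame_def)
  note entries = triangular[THEN triangular_family_adjoin_lastD]
  show "v' j = v j \<or> v' j = - v j"
  proof (rule triangular_columns_unique_up_to_sign)
    show "v k $ k \<noteq> 0" for k
      using entries(1) parseval_span_without_last[OF assms(1) frames(1)]
      by (rule triangular_spanning_diagonal_nonzero)
  qed (simp_all add: entries frames[THEN parseval_row_products])
qed

end
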